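(* Let $n\ge 2$ and let $A=A_1\cdots A_n$ and $B=B_1\cdots B_n$ be strings over $\{\mathrm{H},\mathrm{T}\}$ such that $A$ starts with $\mathrm{HH}$, $B$ starts with $\mathrm{HT}$, and the suffix of $B$ of length $n-2$ equals the prefix of $A$ of length $n-2$ (i.e. $B_{i+2}=A_i$ for $1\le i\le n-2$). Then Bob wins the No-Flippancy game with Alice's string $A$ and Bob's string $B$.
   Context: No-Flippancy game: Alice and Bob have distinct strings $A=A_1\cdots A_n$ and $B=B_1\cdots B_n$ of the same length $n$ over the alphabet $\{\mathrm{H},\mathrm{T}\}$. Starting from the empty sequence, the players alternate turns, Alice going first, and on each turn the current player appends one letter to the sequence (the game output) as follows: let $i<n$ be the maximal length of a suffix of the current sequence that coincides with a prefix of the current player's string ($i=0$ is allowed, via the empty suffix); the player appends the letter with index $i+1$ of their own string. The game ends as soon as $A$ or $B$ appears as a block of consecutive letters in the sequence (necessarily as its suffix, no matter who made the last move); the player whose string appears first wins. If neither string ever appears, the game is infinite. *)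

theory Defs
  imports Main "HOL-Library.Sublist"
begin

datatype letter = H | T

text \<open>Length \<open>i < n\<close> of the longest proper prefix of the player's string \<open>X\<close> that is a suffix of
  the current sequence \<open>s\<close>. For nonempty \<open>X\<close> the set contains \<open>0\<close>, so the maximum exists.\<close>

definition overlap :: "letter list \<Rightarrow> letter list \<Rightarrow> nat" where
  "overlap X s = Max {i. i < length X \<and> suffix (take i X) s}"

text \<open>List indices start at \<open>0\<close>, so the letter with 1-based index \<open>i + 1\<close> is \<open>X ! i\<close>.\<close>

definition move :: "letter list \<Rightarrow> letter list \<Rightarrow> letter list" where
  "move X s = s @ [X ! overlap X s]"

definition game_over :: "letter list \<Rightarrow> letter list \<Rightarrow> letter list \<Rightarrow> bool" where
  "game_over A B s \<longleftrightarrow> sublist A s \<or> sublist B s"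

text \<open>\<open>play A B k\<close> is the sequence after \<open>k\<close> turns; it stays constant once the game has ended.
  Turn \<open>k\<close>, counted from \<open>0\<close>, is Alice's exactly if \<open>k\<close> is even.\<close>

primrec play :: "letter list \<Rightarrow> letter list \<Rightarrow> nat \<Rightarrow> letter list" where
  "play A B 0 = []"
| "play A B (Suc k) =
     (if game_over A B (play A B k) then play A B k
      else move (if even k then A else B) (play A B k))"

text \<open>An infinite game, in which neither string ever appears, is won by nobody.\<close>

definition bob_wins :: "letter list \<Rightarrow> letter list \<Rightarrow> bool" where
  "bob_wins A B \<longleftrightarrow>
     (\<exists>k. sublist B (play A B k) \<and> (\<forall>j\<le>k. \<not> sublist A (play A B j)))"

end

theory Submission
  imports Defs
begin

text \<open>
  Bob's string is \<open>HT\<close> followed by the beginning of Alice's string. As long as the output is a prefix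
  of \<open>B\<close>, Bob continues his own string, and Alice, whose string starts with \<open>HH\<close>, cannot use the
  initial \<open>HT\<close>: her overlap is exactly the part after it, so the letter that she needs next is
  again the next letter of \<open>B\<close>. Hence the output spells out \<open>B\<close>.
\<close>

lemma overlap_eqI:
  assumes "i < length X" and "suffix (take i X) s"
    and "\<And>j. i < j \<Longrightarrow> j < length X \<Longrightarrow> \<not> suffix (take j X) s"
  shows "overlap X s = i"
  unfolding overlap_def
proof (rule Max_eqI)
  fix j assume "j \<in> {i. i < length X \<and> suffix (take i X) s}"
  then show "j \<le> i"
    using assms(3)[of j] by (auto simp: not_le[symmetric])
qed (use assms in auto)

lemma overlap_take_self:
  assumes "k < length X"
  shows "overlap X (take k X) = k"
  using assms by (intro overlap_eqI) (auto dest: suffix_length_le)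

text \<open>A suffix longer than \<open>P\<close> is \<open>T # P\<close> or
  \<open>H # T # P\<close>; the first letter rules out one, the second letter the other.
  \<open>R\<close> may be just \<open>[H]\<close>, hence the \<open>prefix\<close>
  hypothesis.\<close>

lemma prefix_HH_not_suffix_HT:
  assumes "prefix R (H # H # Q)" and "length P < length R"
  shows "\<not> suffix R (H # T # P)"
  using assms by (auto simp: suffix_Cons dest: suffix_length_le)

lemma overlap_HH_HT:
  assumes "prefix [H, H] A" and "k < length A"
  shows "overlap A (H # T # take k A) = k"
proof (rule overlap_eqI)
  show "suffix (take k A) (H # T # take k A)"
    by (simp add: suffix_ConsI)
  fix j assume "k < j" "j < length A"
  moreover obtain Q where "A = H # H # Q"
    using assms(1) by (auto simp: prefix_def)
  then have "prefix (take j A) (H # H # Q)"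
    by (metis take_is_prefix)
  ultimately show "\<not> suffix (take j A) (H # T # take k A)"
    by (intro prefix_HH_not_suffix_HT) auto
qed (fact assms)

lemma not_sublist_shorter: "length t < length s \<Longrightarrow> \<not> sublist s t"
  by (auto dest: sublist_length_le)

lemma play_eq_take:
  assumes A: "prefix [H, H] A" and B: "B = H # T # take (length A - 2) A"
    and "k \<le> length A"
  shows "play A B k = take k B"
  using assms(3)
proof (induction k)
  case 0
  then show ?case by simp
next
  case (Suc k)
  have lenA: "2 \<le> length A" using A by (auto dest: prefix_length_le)
  have lenB: "length B = length A" using lenA B by simp
  have play: "play A B k = take k B" using Suc by simp
  \<comment> \<open>Here \<open>k < length A\<close>, so the output is still too short to contain
    either string.\<close>
  have "\<not> game_over A B (take k B)"
    using Suc.prems lenB by (simp add: game_over_def not_sublist_shorter)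
  moreover have "A ! overlap A (take k B) = B ! k" if "even k"
  proof (cases "k = 0")
    \<comment> \<open>The opening move is separate: the initial \<open>HT\<close> is not there yet,
      but both strings start with \<open>H\<close>.\<close>
    case True
    have "overlap A [] = 0" using lenA by (intro overlap_eqI) auto
    then show ?thesis using True A B by (auto simp: prefix_def)
  next
    case False
    \<comment> \<open>A later turn of Alice has \<open>k\<close> at least 2, so \<open>HT\<close> is
      complete and \<open>m\<close> letters of \<open>A\<close> follow it.\<close>
    with \<open>even k\<close> obtain m where m: "k = Suc (Suc m)"
      by (cases k) (auto elim: oddE)
    then have "take k B = H # T # take m A" and "B ! k = A ! m"
      using B Suc.prems by simp_all
    then show ?thesis using overlap_HH_HT[OF A, of m] m Suc.prems by simp
  qed
  \<comment> \<open>For odd \<open>k\<close>, Bob's overlap with a proper prefix of his own string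
    is all of it.\<close>
  ultimately show ?case
    using Suc.prems lenB play
    by (simp add: move_def overlap_take_self take_Suc_conv_app_nth)
qed

theorem lemma18:
  fixes n :: nat and A B :: "letter list"
  assumes "n \<ge> 2"
    and "length A = n" and "length B = n"
    and "prefix [H, H] A"
    and "prefix [H, T] B"
    and "drop 2 B = take (n - 2) A"
  shows "bob_wins A B"
proof -
  have B: "B = H # T # take (length A - 2) A"
    using assms by (auto simp: prefix_def)
  have play: "play A B j = take j B" if "j \<le> n" for j
    using play_eq_take[OF assms(4) B] that assms(2) by simp
  have "A \<noteq> B" using assms(4,5) by (auto simp: prefix_def)
  \<comment> \<open>Between strings of equal length, containment would mean equality.\<close>
  then have "\<not> sublist A B"
    using assms(2,3) by (auto simp: sublist_def)
  then have "\<not> sublist A (play A B j)" if "j \<le> n" for j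
    using play[OF that] sublist_order.order_trans[OF _ sublist_take] by metis
  moreover have "sublist B (play A B n)"
    using play[of n] assms(3) by simp
  ultimately show ?thesis
    unfolding bob_wins_def by blast
qed

end
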